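(* Let $C\subseteq\mathbb{R}^\infty_{\ge0}$ be a $\mathrm{Sym}$-invariant cone. Then the dual cone $C^*=\{u\in\mathbb{R}^{\mathbb{N}}:\langle u,v\rangle\ge0\text{ for all } v\in C\}$ is not $\mathrm{Sym}$-equivariantly finitely generated, i.e. there is no finite set $A\subset\mathbb{R}^{\mathbb{N}}$ with $C^*=\mathrm{cn}(\mathrm{Sym}(A))$.
   Context: $\mathbb{R}^{\mathbb{N}}$ is the set of all real sequences and $\mathbb{R}^\infty\subseteq\mathbb{R}^{\mathbb{N}}$ the subset of sequences with finitely many nonzero entries; $\mathbb{R}^\infty_{\ge0}$ those with nonnegative entries. For $u\in\mathbb{R}^\infty$, $v\in\mathbb{R}^{\mathbb{N}}$, $\langle u,v\rangle=\sum_i u_iv_i$. $\mathrm{Sym}$ is the group of permutations of $\mathbb{N}$ fixing all but finitely many elements, acting by $\sigma(u)=(u_{\sigma^{-1}(1)},u_{\sigma^{-1}(2)},\dots)$; a set is $\mathrm{Sym}$-invariant if it is stable under this action; $\mathrm{Sym}(A)$ is the orbit set of $A$. $\mathrm{cn}(A)$ denotes the set of finite nonnegative real linear combinations of elements of $A$. *)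

theory Defs
  imports Complex_Main
begin

(* Real sequences are functions nat => real, indexed from 0 instead of from 1. *)

definition R_inf :: "(nat \<Rightarrow> real) set" where
  "R_inf = {u. finite {i. u i \<noteq> 0}}"

definition R_inf_nonneg :: "(nat \<Rightarrow> real) set" where
  "R_inf_nonneg = {u \<in> R_inf. \<forall>i. 0 \<le> u i}"

(* The sum is restricted to the nonzero terms. It is meaningful whenever at least one
   of the two sequences has finite support, whichever argument that is. *)
definition pairing :: "(nat \<Rightarrow> real) \<Rightarrow> (nat \<Rightarrow> real) \<Rightarrow> real" where
  "pairing u v = (\<Sum>i | u i * v i \<noteq> 0. u i * v i)"

definition Sym :: "(nat \<Rightarrow> nat) set" where
  "Sym = {\<sigma>. bij \<sigma> \<and> finite {i. \<sigma> i \<noteq> i}}"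

definition Sym_act :: "(nat \<Rightarrow> nat) \<Rightarrow> (nat \<Rightarrow> real) \<Rightarrow> (nat \<Rightarrow> real)" where
  "Sym_act \<sigma> u = (\<lambda>i. u (inv \<sigma> i))"

definition Sym_invariant :: "(nat \<Rightarrow> real) set \<Rightarrow> bool" where
  "Sym_invariant C \<longleftrightarrow> (\<forall>\<sigma>\<in>Sym. \<forall>u\<in>C. Sym_act \<sigma> u \<in> C)"

definition Sym_orbit :: "(nat \<Rightarrow> real) set \<Rightarrow> (nat \<Rightarrow> real) set" where
  "Sym_orbit A = {Sym_act \<sigma> a | \<sigma> a. \<sigma> \<in> Sym \<and> a \<in> A}"

(* The function space nat => real carries no real_vector instance, so the library's
   convex cones do not apply; linear combinations are written pointwise.
   The empty combination is included, so 0 lies in cn A for every A. *)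
definition cn :: "(nat \<Rightarrow> real) set \<Rightarrow> (nat \<Rightarrow> real) set" where
  "cn A = {(\<lambda>i. \<Sum>a\<in>F. c a * a i) | F c. finite F \<and> F \<subseteq> A \<and> (\<forall>a\<in>F. 0 \<le> c a)}"

(* A cone is a set closed under finite nonnegative linear combinations,
   i.e. a convex cone containing 0. *)
definition is_cone :: "(nat \<Rightarrow> real) set \<Rightarrow> bool" where
  "is_cone C \<longleftrightarrow> cn C = C"

definition dual_cone :: "(nat \<Rightarrow> real) set \<Rightarrow> (nat \<Rightarrow> real) set" where
  "dual_cone C = {u. \<forall>v\<in>C. 0 \<le> pairing u v}"

definition Sym_equivariantly_fin_gen :: "(nat \<Rightarrow> real) set \<Rightarrow> bool" where
  "Sym_equivariantly_fin_gen D \<longleftrightarrow> (\<exists>A. finite A \<and> D = cn (Sym_orbit A))"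

end

theory Submission
  imports Defs "HOL-Library.Landau_Symbols"
begin

text \<open>
  A finitary permutation changes only finitely many entries of a sequence and hence preserves its
  growth. Therefore all elements of \<open>cn (Sym_orbit A)\<close> with \<open>A\<close> finite lie in \<open>O(g)\<close> for one
  single \<open>g\<close>, whereas the dual cone of a set of nonnegative sequences contains all nonnegative
  sequences, however fast they grow.
\<close>

lemma nonneg_in_dual_cone:
  assumes "\<And>v i. v \<in> C \<Longrightarrow> 0 \<le> v i" and "\<And>i. 0 \<le> u i"
  shows "u \<in> dual_cone C"
  using assms by (simp add: dual_cone_def pairing_def sum_nonneg)

lemma eventually_Sym_act_eq:
  assumes "\<sigma> \<in> Sym"
  shows "\<forall>\<^sub>F i in sequentially. Sym_act \<sigma> u i = u i"
proof -
  have "inj \<sigma>" and "finite {i. \<sigma> i \<noteq> i}"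
    using assms by (auto simp: Sym_def bij_is_inj)
  then have "\<forall>\<^sub>F i in sequentially. \<sigma> i = i"
    by (simp add: cofinite_eq_sequentially [symmetric] eventually_cofinite)
  then show ?thesis
    by eventually_elim (simp add: Sym_act_def inv_f_eq \<open>inj \<sigma>\<close>)
qed

lemma Sym_orbit_subset_bigo:
  assumes "A \<subseteq> O(g)"
  shows "Sym_orbit A \<subseteq> O(g)"
proof
  fix b
  assume "b \<in> Sym_orbit A"
  then obtain \<sigma> a where b: "b = Sym_act \<sigma> a" and "\<sigma> \<in> Sym" "a \<in> A"
    by (auto simp: Sym_orbit_def)
  have "b \<in> O(g) \<longleftrightarrow> a \<in> O(g)"
    unfolding b by (intro landau_o.big.in_cong eventually_Sym_act_eq \<open>\<sigma> \<in> Sym\<close>)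
  then show "b \<in> O(g)"
    using \<open>a \<in> A\<close> assms by blast
qed

lemma cn_subset_bigo:
  assumes "A \<subseteq> O[F](g)"
  shows "cn A \<subseteq> O[F](g)"
  using assms by (auto simp: cn_def intro!: big_sum_in_bigo landau_o.big.mult_in_1)

lemma finite_subset_bigo_sum_abs:
  fixes A :: "('a \<Rightarrow> real) set"
  assumes "finite A"
  shows "A \<subseteq> O[F](\<lambda>x. \<Sum>a\<in>A. \<bar>a x\<bar>)"
proof
  fix a
  assume "a \<in> A"
  then have "\<bar>a x\<bar> \<le> (\<Sum>a\<in>A. \<bar>a x\<bar>)" for x
    using assms by (intro member_le_sum) auto
  then have "norm (a x) \<le> norm (\<Sum>a\<in>A. \<bar>a x\<bar>)" for x
    by (simp add: sum_nonneg)
  then show "a \<in> O[F](\<lambda>x. \<Sum>a\<in>A. \<bar>a x\<bar>)"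
    by (intro landau_o.big_mono always_eventually allI)
qed

(* The summand 1 keeps the product away from O(g) where g vanishes. *)
lemma at_top_mult_not_in_bigo:
  fixes g h :: "'a \<Rightarrow> real"
  assumes "filterlim h at_top F" and "F \<noteq> bot"
  shows "(\<lambda>x. h x * (1 + \<bar>g x\<bar>)) \<notin> O[F](g)"
proof
  assume "(\<lambda>x. h x * (1 + \<bar>g x\<bar>)) \<in> O[F](g)"
  then obtain K where "0 < K" and bound: "\<forall>\<^sub>F x in F. \<bar>h x * (1 + \<bar>g x\<bar>)\<bar> \<le> K * \<bar>g x\<bar>"
    by (auto elim: landau_o.bigE)
  have "\<forall>\<^sub>F x in F. K \<le> h x"
    using assms(1) by (simp add: filterlim_at_top)
  with bound have "\<forall>\<^sub>F x in F. False"
  proof eventually_elim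
    case (elim x)
    have "K * \<bar>g x\<bar> < K * (1 + \<bar>g x\<bar>)"
      using \<open>0 < K\<close> by simp
    also have "\<dots> \<le> h x * (1 + \<bar>g x\<bar>)"
      using elim(2) by (intro mult_right_mono) auto
    finally show False
      using elim(1) by linarith
  qed
  then show False
    using assms(2) by (simp add: eventually_False)
qed

theorem theorem4p9:
  fixes C :: "(nat \<Rightarrow> real) set"
  assumes "C \<subseteq> R_inf_nonneg"
    and "is_cone C"
    and "Sym_invariant C"
  shows "\<not> Sym_equivariantly_fin_gen (dual_cone C)"
proof
  assume "Sym_equivariantly_fin_gen (dual_cone C)"
  then obtain A where "finite A" and dual: "dual_cone C = cn (Sym_orbit A)"
    by (auto simp: Sym_equivariantly_fin_gen_def)
  define g where "g i = (\<Sum>a\<in>A. \<bar>a i\<bar>)" for i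
  define u where "u i = real i * (1 + \<bar>g i\<bar>)" for i
  have "A \<subseteq> O(g)"
    unfolding g_def by (rule finite_subset_bigo_sum_abs [OF \<open>finite A\<close>])
  then have "dual_cone C \<subseteq> O(g)"
    unfolding dual by (intro cn_subset_bigo Sym_orbit_subset_bigo)
  moreover have "u \<in> dual_cone C"
    using assms(1) by (intro nonneg_in_dual_cone) (auto simp: R_inf_nonneg_def u_def)
  moreover have "u \<notin> O(g)"
    unfolding u_def by (intro at_top_mult_not_in_bigo filterlim_real_sequentially) simp
  ultimately show False
    by blast
qed

end
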